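(* Let $h\colon\mathbb{R}^n\to\mathbb{R}\cup\{+\infty\}$ be a Legendre function with $0\in\operatorname{int}\operatorname{dom}h$ and $\nabla h(0)=0$. Let $K=\operatorname{cone}(B_K)\subset\mathbb{R}^n$ be a polyhedral cone with normalized conic base $B_K=\{u^1,\ldots,u^p\}$, and assume $\operatorname{aff}(B_K)\subset\operatorname{int}\operatorname{dom}h$ and $0\notin\operatorname{aff}(B_K)$. Suppose the minimizer $c_h:=\operatorname*{arg\,min}_{x\in\operatorname{aff}(B_K)}D_h(x,0)$ exists (it is then unique), and set $\kappa_h:=\langle\nabla h(c_h),c_h\rangle$ and $d_h:=-\nabla h(c_h)$. Then $\langle d_h,u^i\rangle=-\kappa_h$ for each $i=1,\ldots,p$, and for every $v\in\mathbb{R}^n$ with $\|v\|\le\kappa_h$, $$d_h+v\in K^\circ.$$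
   Context: $\langle\cdot,\cdot\rangle$ and $\|\cdot\|$ are the Euclidean inner product and norm. A Legendre function (in the sense of Rockafellar) is a proper, lower semicontinuous, convex function that is essentially smooth and essentially strictly convex, with $\operatorname{int}\operatorname{dom}h\ne\emptyset$. The Bregman divergence is $D_h(x,y):=h(x)-h(y)-\langle\nabla h(y),x-y\rangle$ for $x\in\operatorname{dom}h$, $y\in\operatorname{int}\operatorname{dom}h$. The normalized conic base $B_K$ of a polyhedral cone $K$ is the finite set of unit vectors along its extreme rays; $\operatorname{aff}$ denotes affine hull. The polar cone is $K^\circ=\{w\in\mathbb{R}^n:\langle w,z\rangle\le0\ \text{for all }z\in K\}$. *)

theory Defs
  imports "HOL-Analysis.Analysis"
begin

type_synonym 'n extfun = "real ^ 'n \<Rightarrow> ereal"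

definition edom :: "'n::finite extfun \<Rightarrow> (real ^ 'n) set" where
  "edom h = {x. h x < \<infinity>}"

definition proper_fun :: "'n::finite extfun \<Rightarrow> bool" where
  "proper_fun h \<longleftrightarrow> (\<forall>x. h x \<noteq> -\<infinity>) \<and> edom h \<noteq> {}"

definition lsc_fun :: "'n::finite extfun \<Rightarrow> bool" where
  "lsc_fun h \<longleftrightarrow> (\<forall>x. h x \<le> Liminf (at x) h)"

(* Convexity of an extended-real-valued function is convexity of its epigraph; this avoids
   any convention for the sum of opposite infinities. *)
definition convex_fun :: "'n::finite extfun \<Rightarrow> bool" where
  "convex_fun h \<longleftrightarrow> convex {(x, r::real). h x \<le> ereal r}"

definition subdifferential :: "'n::finite extfun \<Rightarrow> real ^ 'n \<Rightarrow> (real ^ 'n) set" where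
  "subdifferential h x = {w. \<forall>z. h x + ereal (w \<bullet> (z - x)) \<le> h z}"

definition dom_subdifferential :: "'n::finite extfun \<Rightarrow> (real ^ 'n) set" where
  "dom_subdifferential h = {x. subdifferential h x \<noteq> {}}"

(* The gradient of the real-valued function underlying h. It is only meaningful at points of
   interior (edom h) where h is finite and differentiable; near such points
   real_of_ereal (h x) is the value of h, so its junk value 0 outside edom h is harmless. *)
definition grad :: "'n::finite extfun \<Rightarrow> real ^ 'n \<Rightarrow> real ^ 'n" where
  "grad h y = (THE D. GDERIV (\<lambda>x. real_of_ereal (h x)) y :> D)"

definition essentially_smooth :: "'n::finite extfun \<Rightarrow> bool" where
  "essentially_smooth h \<longleftrightarrow>
     interior (edom h) \<noteq> {} \<and>
     (\<forall>x \<in> interior (edom h). (\<lambda>x. real_of_ereal (h x)) differentiable (at x)) \<and>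
     (\<forall>X x. (\<forall>k::nat. X k \<in> interior (edom h)) \<longrightarrow> x \<in> frontier (interior (edom h)) \<longrightarrow>
        X \<longlonglongrightarrow> x \<longrightarrow> filterlim (\<lambda>k. norm (grad h (X k))) at_top sequentially)"

definition strictly_convex_on :: "(real ^ 'n::finite) set \<Rightarrow> 'n extfun \<Rightarrow> bool" where
  "strictly_convex_on C h \<longleftrightarrow>
     (\<forall>x\<in>C. \<forall>y\<in>C. \<forall>t::real. x \<noteq> y \<longrightarrow> 0 < t \<longrightarrow> t < 1 \<longrightarrow>
        h ((1 - t) *\<^sub>R x + t *\<^sub>R y) < ereal (1 - t) * h x + ereal t * h y)"

definition essentially_strictly_convex :: "'n::finite extfun \<Rightarrow> bool" where
  "essentially_strictly_convex h \<longleftrightarrow>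
     (\<forall>C. convex C \<longrightarrow> C \<subseteq> dom_subdifferential h \<longrightarrow> strictly_convex_on C h)"

definition legendre :: "'n::finite extfun \<Rightarrow> bool" where
  "legendre h \<longleftrightarrow>
     proper_fun h \<and> lsc_fun h \<and> convex_fun h \<and>
     essentially_smooth h \<and> essentially_strictly_convex h \<and> interior (edom h) \<noteq> {}"

(* Meaningful for x in edom h and y in interior (edom h). *)
definition bregman :: "'n::finite extfun \<Rightarrow> real ^ 'n \<Rightarrow> real ^ 'n \<Rightarrow> real" where
  "bregman h x y = real_of_ereal (h x) - real_of_ereal (h y) - grad h y \<bullet> (x - y)"

definition polyhedral_cone :: "(real ^ 'n::finite) set \<Rightarrow> bool" where
  "polyhedral_cone K \<longleftrightarrow> polyhedron K \<and> convex_cone K"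

(* An extreme ray is a half-line from the origin that is a face of K; conic hull {u} is the
   half-line {c u | c >= 0}. *)
definition conic_base :: "(real ^ 'n::finite) set \<Rightarrow> (real ^ 'n) set" where
  "conic_base K = {u. norm u = 1 \<and> (conic hull {u}) face_of K}"

definition polar_cone :: "(real ^ 'n::finite) set \<Rightarrow> (real ^ 'n) set" where
  "polar_cone K = {w. \<forall>z\<in>K. w \<bullet> z \<le> 0}"

end

(* Since the gradient of h vanishes at 0, D_h(x, 0) differs from h(x) by a constant, so the gradient
   at the minimizer c is orthogonal to all directions of the affine hull and hence pairs to kappa
   with every generator. On unit vectors, v costs at most norm v <= kappa. Uniqueness is strict
   convexity on the affine hull, where the gradients are subgradients. *)
theory Submission
  imports Defs
begin

lemma finite_on_edom:
  assumes "proper_fun h" "x \<in> edom h"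
  shows "ereal (real_of_ereal (h x)) = h x"
  using assms by (cases "h x") (auto simp: proper_fun_def edom_def)

text \<open>The epigraph contains the points directly above x and y at their function values, hence
  also the segment joining them. Keeping the right-hand side real avoids extended arithmetic
  later.\<close>

lemma convex_fun_le:
  assumes "proper_fun h" "convex_fun h" "x \<in> edom h" "y \<in> edom h" "0 \<le> t" "t \<le> 1"
  shows "h ((1 - t) *\<^sub>R x + t *\<^sub>R y)
    \<le> ereal ((1 - t) * real_of_ereal (h x) + t * real_of_ereal (h y))"
proof -
  let ?E = "{(x, r::real). h x \<le> ereal r}"
  have "(x, real_of_ereal (h x)) \<in> ?E" "(y, real_of_ereal (h y)) \<in> ?E"
    using assms by (simp_all add: finite_on_edom)
  then have "(1 - t) *\<^sub>R (x, real_of_ereal (h x)) + t *\<^sub>R (y, real_of_ereal (h y)) \<in> ?E"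
    using assms unfolding convex_fun_def by (intro convexD) auto
  then show ?thesis by simp
qed

text \<open>Shows that the definite description in \<open>grad\<close> is well defined wherever the
  function is differentiable: existence comes from representing the derivative by a vector,
  uniqueness from that of the derivative.\<close>

lemma GDERIV_grad:
  assumes "(\<lambda>x. real_of_ereal (h x)) differentiable (at x)"
  shows "GDERIV (\<lambda>x. real_of_ereal (h x)) x :> grad h x"
proof -
  let ?f = "\<lambda>x. real_of_ereal (h x)"
  obtain f' where f': "(?f has_derivative f') (at x)"
    using assms by (auto simp: differentiable_def)
  \<comment> \<open>The adjoint of a linear functional maps 1 to its Riesz vector.\<close>
  have "f' = (\<lambda>v. v \<bullet> adjoint f' 1)"
    using adjoint_works[OF has_derivative_linear[OF f'], of _ 1] by (auto simp: fun_eq_iff)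
  then have ex: "GDERIV ?f x :> adjoint f' 1"
    using f' by (simp add: gderiv_def)
  have "D = E" if "GDERIV ?f x :> D" "GDERIV ?f x :> E" for D E
  proof -
    have "(\<lambda>v. v \<bullet> D) = (\<lambda>v. v \<bullet> E)"
      using has_derivative_unique that unfolding gderiv_def by blast
    then show ?thesis by (simp add: fun_eq_iff vector_eq_ldot)
  qed
  with ex show ?thesis unfolding grad_def by (blast intro: theI)
qed

lemma GDERIV_along_line:
  assumes "GDERIV f x :> g"
  shows "((\<lambda>t. f (x + t *\<^sub>R v)) has_real_derivative g \<bullet> v) (at 0)"
proof -
  \<comment> \<open>The base point is written as the value of the line at 0, the form the chain rule
    expects.\<close>
  have "(f has_derivative (\<lambda>w. w \<bullet> g)) (at (x + 0 *\<^sub>R v))"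
    using assms by (simp add: gderiv_def)
  moreover have "((\<lambda>t::real. x + t *\<^sub>R v) has_derivative (\<lambda>t. t *\<^sub>R v)) (at 0)"
    by (auto intro!: derivative_eq_intros)
  ultimately have "((\<lambda>t. f (x + t *\<^sub>R v)) has_derivative (\<lambda>t. (t *\<^sub>R v) \<bullet> g)) (at 0)"
    using has_derivative_compose by fastforce
  moreover have "(\<lambda>t. (t *\<^sub>R v) \<bullet> g) = (*) (g \<bullet> v)"
    by (auto simp: inner_commute)
  ultimately show ?thesis
    by (simp add: has_field_derivative_def)
qed

text \<open>By convexity, the difference quotients from x towards z with step in (0,1) are at most h
  z - h x, and this bound survives the limit to the directional derivative. Outside
  \<open>edom h\<close> the value at z is infinite and nothing is to be shown.\<close>

lemma grad_in_subdifferential: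
  assumes h: "proper_fun h" "convex_fun h" and x: "x \<in> edom h"
    and diff: "(\<lambda>x. real_of_ereal (h x)) differentiable (at x)"
  shows "grad h x \<in> subdifferential h x"
  unfolding subdifferential_def
proof (intro CollectI allI)
  fix z
  let ?f = "\<lambda>x. real_of_ereal (h x)"
  show "h x + ereal (grad h x \<bullet> (z - x)) \<le> h z"
  proof (cases "z \<in> edom h")
    case True
    have "((\<lambda>t. (?f (x + t *\<^sub>R (z - x)) - ?f x) / t) \<longlongrightarrow> grad h x \<bullet> (z - x)) (at_right 0)"
      using GDERIV_along_line[OF GDERIV_grad[OF diff], of "z - x"]
      by (auto simp: has_field_derivative_iff intro: tendsto_within_subset)
    moreover have "eventually (\<lambda>t::real. t \<in> {0<..<1}) (at_right 0)"
      by (rule eventually_at_right_real) simp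
    then have "eventually (\<lambda>t. (?f (x + t *\<^sub>R (z - x)) - ?f x) / t \<le> ?f z - ?f x) (at_right 0)"
    proof eventually_elim
      case (elim t)
      define w where "w = x + t *\<^sub>R (z - x)"
      have "h w \<le> ereal ((1 - t) * ?f x + t * ?f z)"
        using convex_fun_le[OF h x True, of t] elim by (simp add: w_def algebra_simps)
      \<comment> \<open>The finite upper bound puts w into \<open>edom h\<close>, so
        \<open>?f w\<close> is the true value and not the default 0.\<close>
      moreover from this have "ereal (?f w) = h w"
        using h by (intro finite_on_edom) (auto simp: edom_def intro: le_less_trans)
      ultimately have "?f w \<le> (1 - t) * ?f x + t * ?f z"
        by (metis ereal_less_eq(3))
      then show ?case using elim by (simp add: w_def divide_simps algebra_simps)
    qed
    ultimately have "grad h x \<bullet> (z - x) \<le> ?f z - ?f x"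
      by (intro tendsto_upperbound) auto
    then have "ereal (?f x) + ereal (grad h x \<bullet> (z - x)) \<le> ereal (?f z)" by simp
    then show ?thesis using h x True by (simp add: finite_on_edom)
  qed (auto simp: edom_def)
qed

text \<open>Makes essential strict convexity applicable to convex subsets of the interior.\<close>

lemma interior_edom_subset_dom_subdifferential:
  assumes "legendre h"
  shows "interior (edom h) \<subseteq> dom_subdifferential h"
proof
  fix x assume x: "x \<in> interior (edom h)"
  then have "grad h x \<in> subdifferential h x"
    using assms interior_subset
    by (intro grad_in_subdifferential) (auto simp: legendre_def essentially_smooth_def)
  then show "x \<in> dom_subdifferential h" by (auto simp: dom_subdifferential_def)
qed

text \<open>The midpoint of two distinct minimizers would have a strictly smaller value.\<close>

lemma legendre_minimizer_unique:
  assumes h: "legendre h" and A: "convex A" "A \<subseteq> interior (edom h)"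
    and x: "is_arg_min (\<lambda>x. real_of_ereal (h x)) (\<lambda>x. x \<in> A) x"
    and y: "is_arg_min (\<lambda>x. real_of_ereal (h x)) (\<lambda>x. x \<in> A) y"
  shows "x = y"
proof (rule ccontr)
  assume "x \<noteq> y"
  let ?f = "\<lambda>x. real_of_ereal (h x)"
  define m where "m = (1 - 1/2) *\<^sub>R x + (1/2::real) *\<^sub>R y"
  have mem: "x \<in> A" "y \<in> A" using x y by (auto simp: is_arg_min_def)
  have eq: "?f x = ?f y" using x y mem by (force simp: is_arg_min_def)
  have m: "m \<in> A" unfolding m_def using A mem by (intro convexD) auto
  have fin: "ereal (?f z) = h z" if "z \<in> A" for z
    using that h A interior_subset by (intro finite_on_edom) (auto simp: legendre_def)
  have "strictly_convex_on A h"
    using h A interior_edom_subset_dom_subdifferential[OF h]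
    by (auto simp: legendre_def essentially_strictly_convex_def)
  then have "h m < ereal (1 - 1/2) * h x + ereal (1/2) * h y"
    using mem \<open>x \<noteq> y\<close> unfolding strictly_convex_on_def m_def
    by (elim ballE[of _ _ x] ballE[of _ _ y] allE[of _ "1/2"]) auto
  \<comment> \<open>All values on A are finite, so the inequality can be read in the reals; both end
    points have the minimal value, so the average on the right is \<open>?f x\<close>.\<close>
  then have "ereal (?f m) < ereal (1 - 1/2) * ereal (?f x) + ereal (1/2) * ereal (?f y)"
    using fin mem m by simp
  then have "?f m < ?f x" using eq by simp
  then show False using x m by (auto simp: is_arg_min_def)
qed

text \<open>The whole line through c and y stays in A, so t = 0 is a two-sided minimum along it and
  the derivative there vanishes.\<close>

lemma grad_orthogonal_at_minimizer:
  assumes A: "affine A" and y: "y \<in> A"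
    and c: "is_arg_min (\<lambda>x. real_of_ereal (h x)) (\<lambda>x. x \<in> A) c"
    and diff: "(\<lambda>x. real_of_ereal (h x)) differentiable (at c)"
  shows "grad h c \<bullet> (y - c) = 0"
proof -
  let ?g = "\<lambda>t. real_of_ereal (h (c + t *\<^sub>R (y - c)))"
  have "c \<in> A" using c by (simp add: is_arg_min_def)
  then have "c + t *\<^sub>R (y - c) \<in> A" for t
    using mem_affine[OF A _ y, of c "1 - t" t] by (simp add: algebra_simps)
  then have "?g 0 \<le> ?g t" for t
    using c by (simp add: is_arg_min_def not_less)
  \<comment> \<open>The minimum along the line is global, so the radius 1 of the neighbourhood is
    arbitrary.\<close>
  then show ?thesis
    using DERIV_local_min[OF GDERIV_along_line[OF GDERIV_grad[OF diff], of "y - c"], of 1] by auto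
qed

text \<open>The half-space of all z with \<open>w \<bullet> z \<le> 0\<close> is itself a convex
  cone, so it contains the hull once it contains S.\<close>

lemma polar_cone_convex_cone_hull:
  assumes "\<And>z. z \<in> S \<Longrightarrow> w \<bullet> z \<le> 0"
  shows "w \<in> polar_cone (convex_cone hull S)"
proof -
  have "convex_cone hull S \<subseteq> {z. w \<bullet> z \<le> 0}"
    using assms by (intro hull_minimal convex_cone_halfspace_le) auto
  then show ?thesis by (auto simp: polar_cone_def)
qed

theorem theorem10p2:
  fixes h :: "real ^ 'n::finite \<Rightarrow> ereal"
    and K :: "(real ^ 'n) set"
    and u :: "nat \<Rightarrow> real ^ 'n"
    and p :: nat
    and c d :: "real ^ 'n"
    and \<kappa> :: real
  assumes "legendre h"
    and "0 \<in> interior (edom h)"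
    and "grad h 0 = 0"
    and "polyhedral_cone K"
    and "conic_base K = u ` {1..p}"
    and "K = convex_cone hull (conic_base K)"
    and "affine hull (conic_base K) \<subseteq> interior (edom h)"
    and "0 \<notin> affine hull (conic_base K)"
    and "is_arg_min (\<lambda>x. bregman h x 0) (\<lambda>x. x \<in> affine hull (conic_base K)) c"
    and "\<kappa> = grad h c \<bullet> c"
    and "d = - grad h c"
  shows "(\<forall>c'. is_arg_min (\<lambda>x. bregman h x 0) (\<lambda>x. x \<in> affine hull (conic_base K)) c'
              \<longrightarrow> c' = c)
    \<and> (\<forall>i\<in>{1..p}. d \<bullet> u i = - \<kappa>)
    \<and> (\<forall>v. norm v \<le> \<kappa> \<longrightarrow> d + v \<in> polar_cone K)"
proof -
  let ?A = "affine hull (conic_base K)" and ?f = "\<lambda>x. real_of_ereal (h x)"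
  \<comment> \<open>Stated as an equality of predicates so that it serves both c and any competing
    minimizer.\<close>
  have argmin: "is_arg_min (\<lambda>x. bregman h x 0) (\<lambda>x. x \<in> ?A) = is_arg_min ?f (\<lambda>x. x \<in> ?A)"
    using assms(3) by (simp add: fun_eq_iff is_arg_min_def bregman_def)
  have c: "is_arg_min ?f (\<lambda>x. x \<in> ?A) c" using assms(9) argmin by simp
  then have "c \<in> interior (edom h)" using assms(7) by (auto simp: is_arg_min_def)
  then have diff: "?f differentiable (at c)"
    using assms(1) by (simp add: legendre_def essentially_smooth_def)
  \<comment> \<open>Orthogonality to b - c lets b be replaced by c in the inner product with the
    gradient, which leaves \<kappa>.\<close>
  have base: "d \<bullet> b = - \<kappa>" if "b \<in> conic_base K" for b
    using grad_orthogonal_at_minimizer[OF affine_affine_hull hull_inc[OF that] c diff]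
    by (simp add: assms(10,11) inner_diff_right)
  show ?thesis
  proof (intro conjI allI impI ballI)
    fix c' assume "is_arg_min (\<lambda>x. bregman h x 0) (\<lambda>x. x \<in> ?A) c'"
    then show "c' = c"
      using legendre_minimizer_unique[OF assms(1) affine_imp_convex[OF affine_affine_hull] assms(7)]
        argmin c by simp
  next
    fix i assume "i \<in> {1..p}"
    then show "d \<bullet> u i = - \<kappa>" using base assms(5) by blast
  next
    fix v :: "real ^ 'n" assume v: "norm v \<le> \<kappa>"
    have "(d + v) \<bullet> b \<le> 0" if "b \<in> conic_base K" for b
    proof -
      \<comment> \<open>Cauchy-Schwarz, where the normalization of the base removes the factor
        \<open>norm b\<close>.\<close>
      have "v \<bullet> b \<le> norm v"
        using norm_cauchy_schwarz[of v b] that by (simp add: conic_base_def)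
      then show ?thesis using base[OF that] v by (simp add: inner_add_left)
    qed
    then have "d + v \<in> polar_cone (convex_cone hull (conic_base K))"
      by (rule polar_cone_convex_cone_hull)
    then show "d + v \<in> polar_cone K" using assms(6) by simp
  qed
qed

end
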